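(* Let $G$ be a finite simple connected graph which is periodic (in the sense defined in the context). If all the eigenvalues of the transition matrix $T(G)$ are rational numbers, then $\mathrm{diam}(G) < 5$.
   Context: For a finite simple graph $G=(V,E)$, let $\mathcal{A}(G)=\{(u,v),(v,u) : uv\in E\}$ be its set of symmetric arcs; for an arc $e=(u,v)$ write $o(e)=u$, $t(e)=v$ and $e^{-1}=(v,u)$. The Grover transfer matrix $U=U(G)$ is the matrix indexed by $\mathcal{A}(G)$ with entries $U_{e,f}=2/\deg(t(f))$ if $t(f)=o(e)$ and $e\neq f^{-1}$; $U_{e,f}=2/\deg(t(f))-1$ if $e=f^{-1}$; and $U_{e,f}=0$ otherwise. The graph $G$ is called periodic if there is a positive integer $k$ with $U^k=I$ (the identity on $\ell^2(\mathcal{A}(G))$). The transition matrix $T=T(G)$ of simple random walk is indexed by $V$ with $T_{u,v}=1/\deg(u)$ if $u\sim v$ and $0$ otherwise. $\mathrm{diam}(G)$ is the maximum graph distance between two vertices. *)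

theory Defs
  imports
    "Graph_Theory.Graph_Theory"
    "Jordan_Normal_Form.Char_Poly"
    Complex_Main
begin

text \<open>
  A finite simple graph is a \<^locale>\<open>pair_graph\<close>: a finite loop-free symmetric set of
  ordered pairs over a finite vertex set. Its arc set is then precisely the set of symmetric
  arcs, with origin \<^const>\<open>fst\<close>, terminus \<^const>\<open>snd\<close> and inverse \<^const>\<open>prod.swap\<close>.
\<close>

definition enum_list :: "'i set \<Rightarrow> 'i list" where
  "enum_list S = (SOME xs. distinct xs \<and> set xs = S)"

lemma enum_list:
  assumes "finite S"
  shows "distinct (enum_list S)" "set (enum_list S) = S" "length (enum_list S) = card S"
proof -
  have "distinct (enum_list S) \<and> set (enum_list S) = S"
    unfolding enum_list_def by (rule someI_ex) (use finite_distinct_list[OF assms] in blast)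
  then show "distinct (enum_list S)" "set (enum_list S) = S" "length (enum_list S) = card S"
    using distinct_card[of "enum_list S"] by auto
qed

text \<open>
  The matrix with rows and columns indexed by a finite set \<open>S\<close>. The enumeration of \<open>S\<close> is
  arbitrary; another one conjugates the matrix by a permutation matrix, which changes neither
  its eigenvalues nor whether a power of it is the identity.
\<close>

definition indexed_mat :: "'i set \<Rightarrow> ('i \<Rightarrow> 'i \<Rightarrow> complex) \<Rightarrow> complex mat" where
  "indexed_mat S F =
    mat (card S) (card S) (\<lambda>(i, j). F (enum_list S ! i) (enum_list S ! j))"

definition graph_degree :: "'a pair_pre_digraph \<Rightarrow> 'a \<Rightarrow> nat" where
  "graph_degree G v = out_degree (with_proj G) v"

definition grover_entry :: "'a pair_pre_digraph \<Rightarrow> 'a \<times> 'a \<Rightarrow> 'a \<times> 'a \<Rightarrow> complex" where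
  "grover_entry G e f =
    (if snd f = fst e \<and> e \<noteq> prod.swap f then 2 / of_nat (graph_degree G (snd f))
     else if e = prod.swap f then 2 / of_nat (graph_degree G (snd f)) - 1
     else 0)"

definition grover_matrix :: "'a pair_pre_digraph \<Rightarrow> complex mat" where
  "grover_matrix G = indexed_mat (parcs G) (grover_entry G)"

definition periodic_graph :: "'a pair_pre_digraph \<Rightarrow> bool" where
  "periodic_graph G \<longleftrightarrow> (\<exists>k>0. grover_matrix G ^\<^sub>m k = 1\<^sub>m (card (parcs G)))"

definition transition_entry :: "'a pair_pre_digraph \<Rightarrow> 'a \<Rightarrow> 'a \<Rightarrow> complex" where
  "transition_entry G u v =
    (if (u, v) \<in> parcs G then 1 / of_nat (graph_degree G u) else 0)"

definition transition_matrix :: "'a pair_pre_digraph \<Rightarrow> complex mat" where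
  "transition_matrix G = indexed_mat (pverts G) (transition_entry G)"

definition graph_dist :: "'a pair_pre_digraph \<Rightarrow> 'a \<Rightarrow> 'a \<Rightarrow> ereal" where
  "graph_dist G u v = wf_digraph.\<mu> (with_proj G) (\<lambda>_. 1) u v"

definition graph_diam :: "'a pair_pre_digraph \<Rightarrow> ereal" where
  "graph_diam G = Max ((\<lambda>(u, v). graph_dist G u v) ` (pverts G \<times> pverts G))"

end

theory Submission
  imports Defs "HOL-Computational_Algebra.Fundamental_Theorem_Algebra"
begin

text \<open>
  For an eigenfunction \<open>g\<close> of \<open>T\<close> with eigenvalue \<open>a\<close>, the lifts \<open>L g\<close> and \<open>L' g\<close> to arcs
  through origin and terminus satisfy \<open>U (L g) = 2 a L g - L' g\<close> and \<open>U (L' g) = L g\<close>. Hence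
  \<open>U\<^sup>k = I\<close> makes either \<open>L' g\<close> a multiple of \<open>L g\<close>, and then \<open>a = 1\<close> or \<open>a = -1\<close>, or \<open>2 a\<close> a
  root of a monic integral Chebyshev polynomial; a rational such root is an integer, and the
  polynomial does not vanish at integers of modulus at least 2. So \<open>T\<close> has at most the five
  eigenvalues \<open>-1, -1/2, 0, 1/2, 1\<close>. As \<open>T\<close> is self-adjoint for the degree weights, every
  vertex indicator is annihilated by a nonzero polynomial in \<open>T\<close> of degree at most five, which
  is impossible if its degree occurs as a distance from that vertex.
\<close>

section \<open>Matrices over a finite index set as operators on functions\<close>

text \<open>Letting matrices act on functions over the index type hides the arbitrary enumeration
  behind \<open>indexed_mat\<close>. Arguments are read only on \<open>S\<close>, but the result is
  defined at every index.\<close>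

definition mat_op :: "'i set \<Rightarrow> ('i \<Rightarrow> 'i \<Rightarrow> complex) \<Rightarrow> ('i \<Rightarrow> complex) \<Rightarrow> 'i \<Rightarrow> complex" where
  "mat_op S F g s = (\<Sum>t\<in>S. F s t * g t)"

definition indexed_vec :: "'i set \<Rightarrow> ('i \<Rightarrow> complex) \<Rightarrow> complex vec" where
  "indexed_vec S g = vec (card S) (\<lambda>i. g (enum_list S ! i))"

text \<open>This is p(F) x, the polynomial evaluated at the operator of \<open>F\<close> and applied
  to \<open>x\<close>.\<close>

definition poly_action ::
  "'i set \<Rightarrow> ('i \<Rightarrow> 'i \<Rightarrow> complex) \<Rightarrow> complex poly \<Rightarrow> ('i \<Rightarrow> complex) \<Rightarrow> 'i \<Rightarrow> complex" where
  "poly_action S F p x s = (\<Sum>i\<le>degree p. coeff p i * (mat_op S F ^^ i) x s)"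

lemma bij_betw_enum_list:
  assumes "finite S"
  shows "bij_betw (\<lambda>i. enum_list S ! i) {..<card S} S"
  using bij_betw_nth[OF enum_list(1)[OF assms] refl refl] enum_list[OF assms] by simp

lemma indexed_vec_eq_iff:
  assumes "finite S"
  shows "indexed_vec S g = indexed_vec S h \<longleftrightarrow> (\<forall>s\<in>S. g s = h s)"
proof -
  have "indexed_vec S g = indexed_vec S h \<longleftrightarrow>
      (\<forall>i\<in>{..<card S}. g (enum_list S ! i) = h (enum_list S ! i))"
    by (auto simp: indexed_vec_def vec_eq_iff)
  also have "\<dots> \<longleftrightarrow> (\<forall>s\<in>(\<lambda>i. enum_list S ! i) ` {..<card S}. g s = h s)"
    by blast
  also have "(\<lambda>i. enum_list S ! i) ` {..<card S} = S"
    using bij_betw_enum_list[OF assms] by (simp add: bij_betw_def)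
  finally show ?thesis .
qed

lemma indexed_mat_mult_vec:
  assumes "finite S"
  shows "indexed_mat S F *\<^sub>v indexed_vec S g = indexed_vec S (mat_op S F g)"
proof (rule eq_vecI)
  fix i assume "i < dim_vec (indexed_vec S (mat_op S F g))"
  then have i: "i < card S" by (simp add: indexed_vec_def)
  have "(indexed_mat S F *\<^sub>v indexed_vec S g) $ i =
      (\<Sum>j\<in>{..<card S}. F (enum_list S ! i) (enum_list S ! j) * g (enum_list S ! j))"
    using i by (simp add: indexed_mat_def indexed_vec_def scalar_prod_def atLeast0LessThan)
  also have "\<dots> = mat_op S F g (enum_list S ! i)"
    unfolding mat_op_def by (rule sum.reindex_bij_betw[OF bij_betw_enum_list[OF assms]])
  finally show "(indexed_mat S F *\<^sub>v indexed_vec S g) $ i = indexed_vec S (mat_op S F g) $ i"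
    using i by (simp add: indexed_vec_def)
qed (simp add: indexed_mat_def indexed_vec_def)

lemma indexed_mat_pow_mult_vec:
  assumes "finite S"
  shows "(indexed_mat S F ^\<^sub>m k) *\<^sub>v indexed_vec S g = indexed_vec S ((mat_op S F ^^ k) g)"
proof (induction k arbitrary: g)
  case 0
  then show ?case by (simp add: indexed_mat_def indexed_vec_def)
next
  case (Suc k)
  have M: "indexed_mat S F \<in> carrier_mat (card S) (card S)"
    by (simp add: indexed_mat_def)
  have v: "indexed_vec S g \<in> carrier_vec (card S)"
    by (simp add: indexed_vec_def)
  show ?case
    using assoc_mult_mat_vec[OF pow_carrier_mat[OF M] M v] Suc[of "mat_op S F g"]
    by (simp add: indexed_mat_mult_vec[OF assms] funpow_Suc_right del: funpow.simps)
qed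

lemma eigenvalue_indexed_mat:
  assumes "finite S" and "s \<in> S" and "g s \<noteq> 0" and "\<forall>s\<in>S. mat_op S F g s = a * g s"
  shows "eigenvalue (indexed_mat S F) a"
proof -
  have "indexed_vec S g \<noteq> indexed_vec S (\<lambda>_. 0)"
    using assms(2,3) by (auto simp: indexed_vec_eq_iff[OF assms(1)])
  moreover have "indexed_vec S (\<lambda>_. 0) = 0\<^sub>v (card S)"
    by (auto simp: indexed_vec_def)
  moreover have "indexed_vec S (mat_op S F g) = a \<cdot>\<^sub>v indexed_vec S g"
  proof -
    have "indexed_vec S (mat_op S F g) = indexed_vec S (\<lambda>s. a * g s)"
      using assms(4) by (simp add: indexed_vec_eq_iff[OF assms(1)])
    also have "\<dots> = a \<cdot>\<^sub>v indexed_vec S g"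
      by (auto simp: indexed_vec_def)
    finally show ?thesis .
  qed
  ultimately have "eigenvector (indexed_mat S F) (indexed_vec S g) a"
    unfolding eigenvector_def indexed_mat_mult_vec[OF assms(1)]
    by (simp add: indexed_mat_def indexed_vec_def)
  then show ?thesis
    unfolding eigenvalue_def by blast
qed

text \<open>The \<open>card S + 1\<close> functions are the columns of a matrix made square by a
  zero last row. Its determinant vanishes, and a kernel vector supplies the coefficients.\<close>

lemma linear_relation_exists:
  fixes g :: "nat \<Rightarrow> 'i \<Rightarrow> complex"
  assumes "finite S"
  shows "\<exists>c. (\<exists>j\<le>card S. c j \<noteq> 0) \<and> (\<forall>s\<in>S. (\<Sum>j\<le>card S. c j * g j s) = 0)"
proof -
  define n where "n = card S"
  define A where "A = mat (Suc n) (Suc n) (\<lambda>(i, j). if i < n then g j (enum_list S ! i) else 0)"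
  have A: "A \<in> carrier_mat (Suc n) (Suc n)"
    by (simp add: A_def)
  have "det A = (\<Sum>j<Suc n. A $$ (n, j) * cofactor A n j)"
    by (rule laplace_expansion_row[OF A]) simp
  also have "\<dots> = 0"
    by (intro sum.neutral) (auto simp: A_def)
  finally obtain v where v: "v \<in> carrier_vec (Suc n)" "v \<noteq> 0\<^sub>v (Suc n)" "A *\<^sub>v v = 0\<^sub>v (Suc n)"
    using det_0_iff_vec_prod_zero_field[OF A] by blast
  have "\<exists>j\<le>n. v $ j \<noteq> 0"
  proof (rule ccontr)
    assume "\<not> ?thesis"
    then have "v = 0\<^sub>v (Suc n)" using v(1) by (intro eq_vecI) auto
    then show False using v(2) by simp
  qed
  moreover have "(\<Sum>j\<le>n. v $ j * g j s) = 0" if "s \<in> S" for s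
  proof -
    have "s \<in> (\<lambda>i. enum_list S ! i) ` {..<n}"
      using that bij_betw_imp_surj_on[OF bij_betw_enum_list[OF assms]] by (simp add: n_def)
    then obtain i where i: "i < n" "s = enum_list S ! i" by auto
    have "(A *\<^sub>v v) $ i = (\<Sum>j<Suc n. g j s * v $ j)"
      using i v(1) by (simp add: A_def scalar_prod_def atLeast0LessThan del: sum.lessThan_Suc)
    then show ?thesis
      using v(3) i(1) by (simp add: lessThan_Suc_atMost mult.commute)
  qed
  ultimately show ?thesis
    unfolding n_def by blast
qed

section \<open>Polynomials in an operator\<close>

lemma mat_op_cong:
  assumes "\<And>t. t \<in> S \<Longrightarrow> g t = h t"
  shows "mat_op S F g = mat_op S F h"
  using assms by (auto simp: mat_op_def intro!: sum.cong)

lemma mat_op_sum: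
  "mat_op S F (\<lambda>u. \<Sum>i\<in>I. c i * g i u) s = (\<Sum>i\<in>I. c i * mat_op S F (g i) s)"
  unfolding mat_op_def sum_distrib_left
  by (subst sum.swap) (simp add: algebra_simps)

lemma poly_action_altdef:
  assumes "degree p \<le> n"
  shows "poly_action S F p x s = (\<Sum>i\<le>n. coeff p i * (mat_op S F ^^ i) x s)"
  unfolding poly_action_def
  by (rule sum.mono_neutral_left) (use assms in \<open>auto simp: coeff_eq_0\<close>)

text \<open>Splitting off a root \<open>a\<close> of an annihilating polynomial exhibits q(F) x as a
  candidate eigenvector for \<open>a\<close>.\<close>

lemma poly_action_linear_factor:
  "poly_action S F ([:- a, 1:] * q) x s =
    mat_op S F (poly_action S F q x) s - a * poly_action S F q x s"
proof -
  define m where "m i = (mat_op S F ^^ i) x s" for i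
  define n where "n = degree q"
  have "degree ([:- a, 1:] * q) \<le> Suc n"
    unfolding n_def by (rule order.trans[OF degree_mult_le]) simp
  then have "poly_action S F ([:- a, 1:] * q) x s =
      (\<Sum>i\<le>Suc n. coeff (pCons 0 q) i * m i) - a * (\<Sum>i\<le>Suc n. coeff q i * m i)"
    by (simp add: poly_action_altdef m_def algebra_simps sum.distrib sum_distrib_left
        sum_subtractf del: sum.atMost_Suc)
  also have "(\<Sum>i\<le>Suc n. coeff q i * m i) = poly_action S F q x s"
    unfolding m_def by (rule poly_action_altdef[symmetric]) (simp add: n_def)
  also have "(\<Sum>i\<le>Suc n. coeff (pCons 0 q) i * m i) = (\<Sum>i\<le>n. coeff q i * m (Suc i))"
    by (simp add: sum.atMost_Suc_shift del: sum.atMost_Suc)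
  also have "\<dots> = mat_op S F (poly_action S F q x) s"
    by (simp add: poly_action_def[abs_def] mat_op_sum n_def m_def)
  finally show ?thesis .
qed

lemma annihilating_poly_exists:
  assumes "finite S"
  shows "\<exists>p. p \<noteq> 0 \<and> (\<forall>s\<in>S. poly_action S F p x s = 0)"
proof -
  obtain c where c: "\<exists>j\<le>card S. c j \<noteq> 0"
    "\<forall>s\<in>S. (\<Sum>j\<le>card S. c j * (mat_op S F ^^ j) x s) = 0"
    using linear_relation_exists[OF assms, of "\<lambda>j. (mat_op S F ^^ j) x"] by blast
  define p where "p = (\<Sum>j\<le>card S. monom (c j) j)"
  have coeff: "coeff p i = (if i \<le> card S then c i else 0)" for i
    by (simp add: p_def coeff_sum if_distrib cong: if_cong)
  have "degree p \<le> card S"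
    by (rule degree_le) (simp add: coeff)
  then have "\<forall>s\<in>S. poly_action S F p x s = 0"
    using c(2) by (simp add: poly_action_altdef coeff)
  moreover have "p \<noteq> 0"
    using c(1) coeff by (metis coeff_0)
  ultimately show ?thesis by blast
qed

section \<open>Self-adjointness and minimal annihilating polynomials\<close>

text \<open>
  Symmetry of \<open>d s * F s t\<close> makes \<open>F\<close> self-adjoint for the inner product weighted by \<open>d\<close>. Hence
  \<open>(F - a)\<^sup>2 y = 0\<close> forces \<open>(F - a) y = 0\<close> for real \<open>a\<close>, so the minimal annihilating
  polynomial of a vector has only simple roots, and every root is an eigenvalue.
\<close>

lemma selfadjoint_kernel_square:
  fixes d :: "'i \<Rightarrow> real" and F :: "'i \<Rightarrow> 'i \<Rightarrow> complex"
  assumes "finite S" and pos: "\<And>s. s \<in> S \<Longrightarrow> d s > 0"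
    and sym: "\<And>s t. s \<in> S \<Longrightarrow> t \<in> S \<Longrightarrow> of_real (d s) * F s t = cnj (of_real (d t) * F t s)"
    and a: "a \<in> \<real>"
    and w: "\<And>s. s \<in> S \<Longrightarrow> w s = mat_op S F y s - a * y s"
    and ker: "\<And>s. s \<in> S \<Longrightarrow> mat_op S F w s = a * w s"
    and s: "s \<in> S"
  shows "w s = 0"
proof -
  \<comment> \<open>In the weighted inner product, <F y, w> = <y, F w> = a <y, w>, the last equality
    because \<open>a\<close> is real. Hence <w, w> = <F y - a y, w> = 0.\<close>
  have "(\<Sum>s\<in>S. of_real (d s) * mat_op S F y s * cnj (w s)) =
      (\<Sum>s\<in>S. \<Sum>t\<in>S. (of_real (d s) * F s t) * y t * cnj (w s))"
    by (simp add: mat_op_def sum_distrib_left sum_distrib_right algebra_simps)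
  also have "\<dots> = (\<Sum>t\<in>S. \<Sum>s\<in>S. (of_real (d s) * F s t) * y t * cnj (w s))"
    by (rule sum.swap)
  also have "\<dots> = (\<Sum>t\<in>S. \<Sum>s\<in>S. cnj (of_real (d t) * F t s) * y t * cnj (w s))"
    by (intro sum.cong refl) (subst sym, assumption+, rule refl)
  also have "\<dots> = (\<Sum>t\<in>S. of_real (d t) * y t * cnj (mat_op S F w t))"
    by (simp add: mat_op_def sum_distrib_left algebra_simps)
  also have "\<dots> = (\<Sum>t\<in>S. of_real (d t) * (a * y t) * cnj (w t))"
    using a by (intro sum.cong refl) (simp add: ker Reals_cnj_iff)
  finally have "(\<Sum>s\<in>S. of_real (d s) * (mat_op S F y s - a * y s) * cnj (w s)) = 0"
    by (simp add: left_diff_distrib right_diff_distrib sum_subtractf)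
  then have "(\<Sum>s\<in>S. of_real (d s) * w s * cnj (w s)) = 0"
    by (subst sum.cong[OF refl]) (auto simp: w)
  moreover have "(\<Sum>s\<in>S. of_real (d s) * w s * cnj (w s)) =
      of_real (\<Sum>s\<in>S. d s * (cmod (w s))\<^sup>2)"
    by (simp add: complex_norm_square mult.assoc del: of_real_power)
  ultimately have "(\<Sum>s\<in>S. d s * (cmod (w s))\<^sup>2) = 0"
    by (metis of_real_eq_0_iff)
  then have "d s * (cmod (w s))\<^sup>2 = 0"
    using assms(1) s pos by (subst (asm) sum_nonneg_eq_0_iff) (auto simp: less_imp_le)
  then show ?thesis
    using pos[OF s] by simp
qed

text \<open>Over the complex numbers a squarefree polynomial splits into distinct linear factors, so
  its degree counts its roots.\<close>

lemma degree_rsquarefree_le: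
  fixes p :: "complex poly"
  assumes "rsquarefree p" and "finite E" and "{z. poly p z = 0} \<subseteq> E"
  shows "degree p \<le> card E"
proof -
  have p0: "p \<noteq> 0" using assms(1) by (simp add: rsquarefree_def)
  have "p = Polynomial.smult (lead_coeff p) (\<Prod>z | poly p z = 0. [:- z, 1:])"
    using complex_poly_decompose_rsquarefree[OF assms(1)] by simp
  then have "degree p = degree (\<Prod>z | poly p z = 0. [:- z, 1:])"
    using p0 by (metis degree_smult_eq leading_coeff_0_iff)
  also have "\<dots> = card {z. poly p z = 0}"
    by (subst degree_prod_eq_sum_degree) auto
  also have "\<dots> \<le> card E"
    by (rule card_mono[OF assms(2,3)])
  finally show ?thesis .
qed

lemma selfadjoint_annihilating_poly:
  fixes d :: "'i \<Rightarrow> real" and F :: "'i \<Rightarrow> 'i \<Rightarrow> complex"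
  assumes fin: "finite S" and pos: "\<And>s. s \<in> S \<Longrightarrow> d s > 0"
    and sym: "\<And>s t. s \<in> S \<Longrightarrow> t \<in> S \<Longrightarrow> of_real (d s) * F s t = cnj (of_real (d t) * F t s)"
    and E: "finite E" "E \<subseteq> \<real>"
    and eig: "\<And>a g s. s \<in> S \<Longrightarrow> g s \<noteq> 0 \<Longrightarrow> \<forall>s\<in>S. mat_op S F g s = a * g s \<Longrightarrow> a \<in> E"
  shows "\<exists>p. p \<noteq> 0 \<and> degree p \<le> card E \<and> (\<forall>s\<in>S. poly_action S F p x s = 0)"
proof -
  define P where "P p \<longleftrightarrow> p \<noteq> 0 \<and> (\<forall>s\<in>S. poly_action S F p x s = 0)" for p
  obtain p where p: "P p" and min: "\<And>q. P q \<Longrightarrow> degree p \<le> degree q"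
    using annihilating_poly_exists[OF fin, of F x] arg_min_nat_lemma[of P _ degree]
    unfolding P_def by blast
  have p0: "p \<noteq> 0" using p by (simp add: P_def)
  \<comment> \<open>By minimality of the degree of \<open>p\<close>, the cofactor \<open>q\<close>
    does not annihilate \<open>x\<close>. So \<open>w\<close>, which is q(F) x, is an eigenvector
    for \<open>a\<close>.\<close>
  have root: "a \<in> E \<and> poly q a \<noteq> 0" if pq: "p = [:- a, 1:] * q" for a q
  proof -
    define w where "w = poly_action S F q x"
    have q0: "q \<noteq> 0" using p0 pq by auto
    then have "degree p = Suc (degree q)"
      unfolding pq by (subst degree_mult_eq) auto
    then have "\<not> P q" using min[of q] by auto
    then obtain s where s: "s \<in> S" "w s \<noteq> 0"
      using q0 unfolding P_def w_def by blast
    have ker: "mat_op S F w s = a * w s" if "s \<in> S" for s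
    proof -
      have "poly_action S F p x s = mat_op S F w s - a * w s"
        unfolding pq w_def by (rule poly_action_linear_factor)
      then show ?thesis using p that unfolding P_def by simp
    qed
    have "a \<in> E" using eig[of s w a] s ker by blast
    moreover have "poly q a \<noteq> 0"
    proof
      \<comment> \<open>A double root would put \<open>w\<close> both in the kernel and in the image
        of F - a, and self-adjointness forces such a \<open>w\<close> to vanish.\<close>
      assume "poly q a = 0"
      then obtain r where r: "q = [:- a, 1:] * r"
        by (auto simp: poly_eq_0_iff_dvd)
      have "w s = mat_op S F (poly_action S F r x) s - a * poly_action S F r x s" for s
        unfolding w_def r by (rule poly_action_linear_factor)
      then have "w s = 0"
        using \<open>a \<in> E\<close> E(2) ker s(1)
        by (intro selfadjoint_kernel_square[where a = a and w = w and F = F and d = d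
              and y = "poly_action S F r x" and s = s, OF fin pos sym]) auto
      then show False using s(2) by simp
    qed
    ultimately show ?thesis by blast
  qed
  have "rsquarefree p"
    unfolding rsquarefree_def
  proof (intro conjI allI)
    fix a
    show "order a p = 0 \<or> order a p = 1"
    proof (rule ccontr)
      assume "\<not> ?thesis"
      then have "[:- a, 1:] ^ 2 dvd p"
        using order_divides[of a 2 p] by linarith
      then obtain r where "p = [:- a, 1:] * ([:- a, 1:] * r)"
        unfolding power2_eq_square dvd_def mult.assoc by blast
      from root[OF this] show False by simp
    qed
  qed (fact p0)
  moreover have "{z. poly p z = 0} \<subseteq> E"
    using root by (auto simp: poly_eq_0_iff_dvd elim!: dvdE)
  ultimately show ?thesis
    using degree_rsquarefree_le[OF _ E(1)] p unfolding P_def by blast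
qed

section \<open>Integral Chebyshev polynomials and their rational roots\<close>

text \<open>
  These are the Chebyshev polynomials of the second kind, rescaled to be monic over the integers
  and with index shifted by one: \<open>cheb (Suc n) (2 * cos \<theta>) = sin ((n + 1) * \<theta>) / sin \<theta>\<close>.
\<close>

fun cheb :: "nat \<Rightarrow> 'b \<Rightarrow> 'b::comm_ring_1" where
  "cheb 0 x = 0"
| "cheb (Suc 0) x = 1"
| "cheb (Suc (Suc n)) x = x * cheb (Suc n) x - cheb n x"

text \<open>\<open>cheb\<close> is generic in the ring: inserting the indeterminate
  \<open>[:0, 1:]\<close> yields the polynomial itself, and evaluation commutes with the
  recursion.\<close>

lemma poly_cheb: "poly (cheb n p) x = cheb n (poly p x)"
  by (induction n p rule: cheb.induct) simp_all

lemma of_int_cheb: "of_int (cheb n m) = cheb n (of_int m)"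
  by (induction n m rule: cheb.induct) simp_all

lemma coeff_cheb_Ints: "coeff (cheb n [:0, 1:] :: complex poly) i \<in> \<int>"
proof (induction n "[:0, 1:] :: complex poly" arbitrary: i rule: cheb.induct)
  case 2
  then show ?case by (simp add: coeff_1)
next
  case (3 n)
  then show ?case by (cases i) simp_all
qed simp

text \<open>The leading term of x times the previous polynomial survives, as the subtracted one has
  smaller degree. Together with integral coefficients this makes every root an algebraic
  integer.\<close>

lemma cheb_monic:
  "degree (cheb (Suc n) [:0, 1:] :: complex poly) = n \<and>
    lead_coeff (cheb (Suc n) [:0, 1:] :: complex poly) = 1"
proof (induction n rule: less_induct)
  case (less n)
  let ?c = "\<lambda>n. cheb n [:0, 1:] :: complex poly"
  show ?case
  proof (cases n)
    case (Suc m)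
    have m: "degree (?c n) = m" "lead_coeff (?c n) = 1"
      using less[of m] Suc by auto
    then have "?c n \<noteq> 0" by force
    then have deg: "degree ([:0, 1:] * ?c n) = n"
      using m Suc by simp
    \<comment> \<open>For \<open>m = 0\<close> the polynomial is zero, of degree 0 by convention,
      while \<open>n\<close> is 1.\<close>
    have "degree (?c m) < n"
    proof (cases m)
      case (Suc k)
      then show ?thesis using less[of k] \<open>n = Suc m\<close> by simp
    qed (simp add: Suc)
    then have "coeff (?c (Suc n)) n = 1" "degree (?c (Suc n)) \<le> n"
      using deg m Suc degree_diff_le[of "[:0, 1:] * ?c n" n "?c m"]
      by (auto simp: coeff_eq_0)
    then show ?thesis
      using le_degree[of "?c (Suc n)" n] by auto
  qed simp
qed

text \<open>The recursion gives |c(n+2)| >= 2 |c(n+1)| - |c(n)| > |c(n+1)|. Hence no integer of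
  modulus at least 2 is a root at a positive index.\<close>

lemma cheb_strict_growth:
  fixes m :: int
  assumes "\<bar>m\<bar> \<ge> 2"
  shows "\<bar>cheb n m\<bar> < \<bar>cheb (Suc n) m\<bar>"
proof (induction n)
  case (Suc n)
  have "2 * \<bar>cheb (Suc n) m\<bar> \<le> \<bar>m * cheb (Suc n) m\<bar>"
    using assms by (simp add: abs_mult mult_right_mono)
  then show ?case using Suc by simp
qed simp

lemma cheb_rational_root:
  fixes x :: complex
  assumes "k > 0" and "cheb k x = 0" and "x \<in> \<rat>"
  shows "x \<in> {-1, 0, 1}"
proof -
  obtain n where k: "k = Suc n" using assms(1) by (cases k) auto
  have "algebraic_int x"
    using cheb_monic[of n] coeff_cheb_Ints assms(2)
    by (intro algebraic_int.intros[of "cheb k [:0, 1:]"]) (auto simp: k poly_cheb simp del: cheb.simps)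
  then have "x \<in> \<int>"
    using assms(3) by (rule rational_algebraic_int_is_int)
  then obtain m where m: "x = of_int m" by (auto elim: Ints_cases)
  have "cheb k m = 0"
    using assms(2) unfolding m of_int_cheb[symmetric] by simp
  then have "\<not> \<bar>m\<bar> \<ge> 2"
    using cheb_strict_growth[of m n] by (auto simp: k)
  then have "m = -1 \<or> m = 0 \<or> m = 1" by linarith
  then show ?thesis by (auto simp: m)
qed

section \<open>The Grover and transition operators of a graph\<close>

context pair_graph
begin

lemma graph_degree_eq_card: "graph_degree G u = card {v \<in> pverts G. (u, v) \<in> parcs G}"
proof -
  have "out_arcs (with_proj G) u = Pair u ` {v \<in> pverts G. (u, v) \<in> parcs G}"
    by (auto simp: out_arcs_def dest: in_arcsD2)
  then show ?thesis
    by (simp add: graph_degree_def out_degree_def card_image inj_on_def)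
qed

lemma graph_degree_pos:
  assumes "(u, v) \<in> parcs G"
  shows "graph_degree G u > 0"
  using assms pair_finite_verts
  by (auto simp: graph_degree_eq_card card_gt_0_iff dest: in_arcsD2)

text \<open>No condition on \<open>u\<close> is imposed: where the degree is 0, both sides are
  0.\<close>

lemma transition_op:
  "mat_op (pverts G) (transition_entry G) g u =
    (\<Sum>v | v \<in> pverts G \<and> (u, v) \<in> parcs G. g v) / of_nat (graph_degree G u)"
proof -
  have "mat_op (pverts G) (transition_entry G) g u =
      (\<Sum>v\<in>pverts G. if (u, v) \<in> parcs G then g v / of_nat (graph_degree G u) else 0)"
    unfolding mat_op_def by (intro sum.cong) (auto simp: transition_entry_def)
  also have "\<dots> = (\<Sum>v | v \<in> pverts G \<and> (u, v) \<in> parcs G. g v / of_nat (graph_degree G u))"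
    by (rule sum.inter_filter[OF pair_finite_verts, symmetric])
  finally show ?thesis by (simp add: sum_divide_distrib)
qed

lemma grover_op:
  assumes "(u, v) \<in> parcs G"
  shows "mat_op (parcs G) (grover_entry G) \<psi> (u, v) =
    2 / of_nat (graph_degree G u) * (\<Sum>w | w \<in> pverts G \<and> (u, w) \<in> parcs G. \<psi> (w, u)) - \<psi> (v, u)"
proof -
  have vu: "(v, u) \<in> parcs G" using assms by (rule arcs_symmetric)
  \<comment> \<open>Both nonzero cases of \<open>grover_entry\<close> contain 2 / deg u; the
    reversed arc \<open>(v, u)\<close> only adds the extra -1.\<close>
  have "mat_op (parcs G) (grover_entry G) \<psi> (u, v) =
      (\<Sum>f\<in>parcs G. (if snd f = u then 2 / of_nat (graph_degree G u) * \<psi> f else 0) -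
        (if f = (v, u) then \<psi> f else 0))"
    unfolding mat_op_def
    by (intro sum.cong) (auto simp: grover_entry_def algebra_simps split: prod.splits)
  also have "\<dots> = (\<Sum>f | f \<in> parcs G \<and> snd f = u. 2 / of_nat (graph_degree G u) * \<psi> f) - \<psi> (v, u)"
    using vu by (simp add: sum_subtractf sum.inter_filter pair_finite_arcs del: times_divide_eq_left)
  also have "{f. f \<in> parcs G \<and> snd f = u} =
      (\<lambda>w. (w, u)) ` {w. w \<in> pverts G \<and> (u, w) \<in> parcs G}"
    by (auto simp: image_iff intro: in_arcsD1 arcs_symmetric)
  finally show ?thesis
    by (simp add: sum.reindex inj_on_def sum_distrib_left)
qed

text \<open>The span of the two lifts of \<open>g\<close> is invariant under U: the sum over arcs
  into \<open>u\<close> averages \<open>g\<close> over the neighbours, where the eigenvalue equation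
  applies.\<close>

lemma grover_op_lift:
  assumes eig: "\<forall>u\<in>pverts G. mat_op (pverts G) (transition_entry G) g u = a * g u"
    and uv: "(u, v) \<in> parcs G"
  shows "mat_op (parcs G) (grover_entry G) (\<lambda>e. A * g (fst e) + B * g (snd e)) (u, v) =
    (2 * a * A + B) * g u - A * g v"
proof -
  define N where "N = {w. w \<in> pverts G \<and> (u, w) \<in> parcs G}"
  define k where "k = graph_degree G u"
  have k: "k > 0" "card N = k"
    using graph_degree_pos[OF uv] by (auto simp: k_def N_def graph_degree_eq_card)
  have "(\<Sum>w\<in>N. g w) / of_nat k = a * g u"
    using eig in_arcsD1[OF uv] unfolding transition_op k_def N_def by blast
  then have sum: "(\<Sum>w\<in>N. g w) = of_nat k * (a * g u)"
    using k by (simp add: field_simps)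
  have "(\<Sum>w\<in>N. A * g w + B * g u) = of_nat k * (A * a * g u + B * g u)"
    unfolding sum.distrib sum_distrib_left[symmetric] sum by (simp add: k algebra_simps)
  then show ?thesis
    unfolding grover_op[OF uv] N_def[symmetric] k_def[symmetric]
    using k by (simp add: field_simps)
qed

text \<open>The coefficient map (A, B) to (2 a A + B, -A), started at (1, 0), is the recursion of
  \<open>cheb\<close> at \<open>2 * a\<close>.\<close>

lemma grover_op_pow_lift:
  assumes eig: "\<forall>u\<in>pverts G. mat_op (pverts G) (transition_entry G) g u = a * g u"
    and "(u, v) \<in> parcs G"
  shows "(mat_op (parcs G) (grover_entry G) ^^ n) (\<lambda>e. g (fst e)) (u, v) =
    cheb (Suc n) (2 * a) * g u - cheb n (2 * a) * g v"
  using assms(2)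
proof (induction n arbitrary: u v)
  case (Suc n)
  let ?H = "mat_op (parcs G) (grover_entry G)"
  have "?H ((?H ^^ n) (\<lambda>e. g (fst e))) =
      ?H (\<lambda>e. cheb (Suc n) (2 * a) * g (fst e) + (- cheb n (2 * a)) * g (snd e))"
    by (rule mat_op_cong) (use Suc.IH in auto)
  then show ?case
    using grover_op_lift[OF eig Suc.prems, of "cheb (Suc n) (2 * a)" "- cheb n (2 * a)"] by simp
qed simp

lemma periodic_transition_eigenvalue:
  assumes "periodic_graph G" and "a \<in> \<rat>"
    and nbr: "\<And>u. u \<in> pverts G \<Longrightarrow> \<exists>v. (u, v) \<in> parcs G"
    and eig: "\<forall>u\<in>pverts G. mat_op (pverts G) (transition_entry G) g u = a * g u"
    and u: "u \<in> pverts G" "g u \<noteq> 0"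
  shows "a \<in> {-1, -1/2, 0, 1/2, 1}"
proof -
  obtain k where k: "k > 0" "grover_matrix G ^\<^sub>m k = 1\<^sub>m (card (parcs G))"
    using assms(1) unfolding periodic_graph_def by blast
  have "indexed_vec (parcs G) ((mat_op (parcs G) (grover_entry G) ^^ k) (\<lambda>e. g (fst e))) =
      indexed_vec (parcs G) (\<lambda>e. g (fst e))"
    using indexed_mat_pow_mult_vec[OF pair_finite_arcs, of "grover_entry G" k "\<lambda>e. g (fst e)"]
      k(2) by (simp add: grover_matrix_def indexed_vec_def)
  then have rel: "cheb (Suc k) (2 * a) * g u - cheb k (2 * a) * g v = g u"
    if "(u, v) \<in> parcs G" for u v
    using that grover_op_pow_lift[OF eig that, of k]
    by (auto simp: indexed_vec_eq_iff[OF pair_finite_arcs] simp del: cheb.simps)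
  show ?thesis
  proof (cases "cheb k (2 * a) = 0")
    case True
    have "2 * a \<in> {-1, 0, 1}"
      by (rule cheb_rational_root[OF k(1) True]) (use assms(2) in simp)
    then have "a = - (1/2) \<or> a = 0 \<or> a = 1/2"
      by (auto simp: field_simps)
    then show ?thesis by auto
  next
    case False
    \<comment> \<open>With a nonzero coefficient, \<open>rel\<close> determines g v from g u by one
      factor \<open>c\<close> for all arcs. Crossing an arc back and forth gives c * c = 1, and
      averaging over neighbours gives a = c.\<close>
    define c where "c = (cheb (Suc k) (2 * a) - 1) / cheb k (2 * a)"
    have c: "g v = c * g u" if "(u, v) \<in> parcs G" for u v
      using rel[OF that] False unfolding c_def by (simp add: field_simps del: cheb.simps)
    obtain v where v: "(u, v) \<in> parcs G" using nbr[OF u(1)] by blast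
    have "g u = c * (c * g u)"
      using c[OF v] c[OF arcs_symmetric[OF v]] by simp
    then have "c * c = 1" using u(2) by simp
    then have "c = 1 \<or> c = -1" by (simp add: square_eq_1_iff)
    moreover have "a = c"
    proof -
      have "a * g u = (\<Sum>v | v \<in> pverts G \<and> (u, v) \<in> parcs G. c * g u) / of_nat (graph_degree G u)"
      proof -
        have "(\<Sum>v | v \<in> pverts G \<and> (u, v) \<in> parcs G. g v) =
            (\<Sum>v | v \<in> pverts G \<and> (u, v) \<in> parcs G. c * g u)"
          by (intro sum.cong) (auto intro: c)
        then show ?thesis using eig u(1) unfolding transition_op by metis
      qed
      also have "\<dots> = c * g u"
        using graph_degree_pos[OF v] by (simp add: graph_degree_eq_card[symmetric])
      finally show ?thesis using u(2) by simp
    qed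
    ultimately show ?thesis by auto
  qed
qed

section \<open>Walks, distances and powers of the transition operator\<close>

text \<open>All terms are nonnegative reals, so nothing cancels and the support of T^n applied to
  the indicator of \<open>v\<close> consists of the starts of walks of length \<open>n\<close> to
  \<open>v\<close>.\<close>

lemma transition_pow_delta:
  "\<exists>r\<ge>0. (mat_op (pverts G) (transition_entry G) ^^ n) (\<lambda>w. if w = v then 1 else 0) u =
      complex_of_real r \<and> (r > 0 \<longleftrightarrow> (u, v) \<in> parcs G ^^ n)"
proof (induction n arbitrary: u)
  case 0
  then show ?case by (auto intro: exI[of _ 1] exI[of _ 0])
next
  case (Suc n)
  let ?T = "mat_op (pverts G) (transition_entry G)"
  let ?\<delta> = "\<lambda>w. if w = v then 1 else 0 :: complex"
  obtain r where r: "\<And>u. r u \<ge> 0" "\<And>u. (?T ^^ n) ?\<delta> u = complex_of_real (r u)"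
    "\<And>u. r u > 0 \<longleftrightarrow> (u, v) \<in> parcs G ^^ n"
    using Suc by metis
  define N where "N = {w. w \<in> pverts G \<and> (u, w) \<in> parcs G}"
  have fin: "finite N" using pair_finite_verts by (simp add: N_def)
  define q where "q = (\<Sum>w\<in>N. r w) / graph_degree G u"
  have "(?T ^^ Suc n) ?\<delta> u = complex_of_real q"
    by (simp add: transition_op r(2) q_def N_def)
  moreover have "q \<ge> 0"
    by (simp add: q_def sum_nonneg r(1))
  moreover have "q > 0 \<longleftrightarrow> (u, v) \<in> parcs G ^^ Suc n"
  proof
    assume "q > 0"
    then have "(\<Sum>w\<in>N. r w) \<noteq> 0" by (auto simp: q_def)
    then obtain w where "w \<in> N" "r w \<noteq> 0" by (meson sum.neutral)
    then show "(u, v) \<in> parcs G ^^ Suc n"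
      using r(1)[of w] r(3)[of w] by (auto simp: N_def simp del: relpow.simps(2) intro: relpow_Suc_I2)
  next
    assume "(u, v) \<in> parcs G ^^ Suc n"
    then obtain w where w: "(u, w) \<in> parcs G" "(w, v) \<in> parcs G ^^ n"
      by (meson relpow_Suc_D2)
    then have "w \<in> N" "r w > 0" using r(3) by (auto simp: N_def dest: in_arcsD2)
    then have "(\<Sum>w\<in>N. r w) > 0" using fin r(1) by (meson sum_pos2)
    then show "q > 0"
      using graph_degree_pos[OF w(1)] by (simp add: q_def)
  qed
  ultimately show ?case by blast
qed

lemma awalk_imp_relpow: "awalk u p v \<Longrightarrow> (u, v) \<in> parcs G ^^ length p"
  by (induction p arbitrary: u)
    (auto simp: awalk_Nil_iff awalk_Cons_iff simp del: relpow.simps(2) intro: relpow_Suc_I2)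

text \<open>The zeroth relation power is the identity on the whole type, whereas an empty walk must
  sit at a vertex; hence the condition on \<open>v\<close>.\<close>

lemma relpow_imp_awalk:
  assumes "(u, v) \<in> parcs G ^^ n" and "v \<in> pverts G"
  shows "\<exists>p. awalk u p v \<and> length p = n"
  using assms(1)
proof (induction n arbitrary: u)
  case 0
  then show ?case using assms(2) by (auto simp: awalk_Nil_iff)
next
  case (Suc n)
  then obtain w p where "(u, w) \<in> parcs G" "awalk w p v" "length p = n"
    by (meson relpow_Suc_D2)
  then have "awalk u ((u, w) # p) v \<and> length ((u, w) # p) = Suc n"
    by (auto simp: awalk_Cons_iff)
  then show ?case by blast
qed

lemma graph_dist_le_relpow:
  assumes "(u, v) \<in> parcs G ^^ n" and "v \<in> pverts G"
  shows "graph_dist G u v \<le> ereal (real n)"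
proof -
  obtain p where p: "awalk u p v" "length p = n"
    using relpow_imp_awalk[OF assms] by blast
  have "awalk_cost (\<lambda>_. 1) p = real (length p)" for p :: "('a \<times> 'a) list"
    by (induction p) (auto simp: awalk_cost_def)
  then show ?thesis
    using min_cost_le_walk_cost[OF p(1), of "\<lambda>_. 1"] p(2) by (simp add: graph_dist_def)
qed

lemma connected_imp_relpow:
  assumes "Digraph_Component.connected (with_proj G)" and "u \<in> pverts G" and "v \<in> pverts G"
  shows "\<exists>n. (u, v) \<in> parcs G ^^ n"
proof -
  \<comment> \<open>Connectedness means strong connectedness of the symmetric closure, which is here
    \<open>G\<close> itself.\<close>
  have "(\<Union>e\<in>parcs G. {(fst e, snd e), (snd e, fst e)}) = parcs G"
    by (auto intro: arcs_symmetric)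
  then have "mk_symmetric (with_proj G) = G"
    by (simp add: mk_symmetric_def)
  then have "u \<rightarrow>\<^sup>*\<^bsub>with_proj G\<^esub> v"
    using assms by (simp add: Digraph_Component.connected_def strongly_connected_def)
  then show ?thesis
    by (meson awalk_imp_relpow reachable_awalk)
qed

text \<open>Cut a shortest walk \<open>d\<close> steps before its end: a shorter way on from the cut
  would shorten the whole walk.\<close>

lemma relpow_intermediate_distance:
  assumes "(u, v) \<in> parcs G ^^ n" and "\<And>j. (u, v) \<in> parcs G ^^ j \<Longrightarrow> n \<le> j" and "d \<le> n"
  shows "\<exists>w. (w, v) \<in> parcs G ^^ d \<and> (\<forall>j<d. (w, v) \<notin> parcs G ^^ j)"
proof -
  have "(u, v) \<in> parcs G ^^ (n - d) O parcs G ^^ d"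
    using assms(1,3) by (simp flip: relpow_add)
  then obtain w where w: "(u, w) \<in> parcs G ^^ (n - d)" "(w, v) \<in> parcs G ^^ d" by blast
  have "(w, v) \<notin> parcs G ^^ j" if "j < d" for j
  proof
    assume "(w, v) \<in> parcs G ^^ j"
    then have "(u, v) \<in> parcs G ^^ (n - d + j)"
      using w(1) by (auto simp: relpow_add)
    then show False using assms(2)[of "n - d + j"] that assms(3) by simp
  qed
  then show ?thesis using w(2) by blast
qed

text \<open>If the distance from \<open>w\<close> to \<open>v\<close> were exactly
  \<open>degree p\<close>, only the leading term of p(T) applied to the indicator of
  \<open>v\<close> would survive at \<open>w\<close>.\<close>

lemma transition_annihilating_poly_degree:
  assumes ann: "\<forall>s\<in>pverts G.
      poly_action (pverts G) (transition_entry G) p (\<lambda>w. if w = v then 1 else 0) s = 0"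
    and "p \<noteq> 0" and w: "w \<in> pverts G" "(w, v) \<in> parcs G ^^ degree p"
  shows "\<exists>j<degree p. (w, v) \<in> parcs G ^^ j"
proof (rule ccontr)
  assume no: "\<not> ?thesis"
  let ?m = "\<lambda>i. (mat_op (pverts G) (transition_entry G) ^^ i) (\<lambda>w. if w = v then 1 else 0) w"
  have nz: "?m i \<noteq> 0 \<longleftrightarrow> (w, v) \<in> parcs G ^^ i" for i
    using transition_pow_delta[of i v w] by force
  have "0 = (\<Sum>i\<le>degree p. coeff p i * ?m i)"
    using ann w(1) by (simp add: poly_action_def)
  also have "\<dots> = (\<Sum>i\<in>{degree p}. coeff p i * ?m i)"
    by (rule sum.mono_neutral_right) (use no nz in force)+
  finally show False
    using nz[of "degree p"] w(2) \<open>p \<noteq> 0\<close> by simp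
qed

section \<open>The bound on distances and on the diameter\<close>

lemma periodic_rational_distance:
  assumes "periodic_graph G"
    and rat: "\<forall>z. eigenvalue (transition_matrix G) z \<longrightarrow> z \<in> \<rat>"
    and nbr: "\<And>u. u \<in> pverts G \<Longrightarrow> \<exists>v. (u, v) \<in> parcs G"
    and uv: "(u, v) \<in> parcs G ^^ n" "\<And>j. (u, v) \<in> parcs G ^^ j \<Longrightarrow> n \<le> j"
    and v: "v \<in> pverts G"
  shows "n \<le> 4"
proof (rule ccontr)
  assume n: "\<not> n \<le> 4"
  let ?T = "transition_entry G"
  define E :: "complex set" where "E = {-1, -1/2, 0, 1/2, 1}"
  have E: "finite E" "E \<subseteq> \<real>" by (auto simp: E_def)
  have "card E \<le> 5"
    unfolding E_def by (simp add: card_insert_if)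
  have "\<exists>p. p \<noteq> 0 \<and> degree p \<le> card E \<and>
      (\<forall>s\<in>pverts G. poly_action (pverts G) ?T p (\<lambda>w. if w = v then 1 else 0) s = 0)"
  proof (rule selfadjoint_annihilating_poly[where d = "\<lambda>u. real (graph_degree G u)"])
    show "0 < real (graph_degree G s)" if "s \<in> pverts G" for s
      using nbr[OF that] graph_degree_pos by auto
    \<comment> \<open>Scaling the rows of T by the degrees gives the adjacency matrix, which is real
      and symmetric.\<close>
    show "complex_of_real (real (graph_degree G s)) * ?T s t =
        cnj (complex_of_real (real (graph_degree G t)) * ?T t s)" for s t
      using graph_degree_pos[of s t] graph_degree_pos[of t s]
      by (auto simp: transition_entry_def dest: arcs_symmetric)
    show "a \<in> E" if "s \<in> pverts G" "g s \<noteq> 0" "\<forall>s\<in>pverts G. mat_op (pverts G) ?T g s = a * g s"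
      for a g s
      unfolding E_def
    proof (rule periodic_transition_eigenvalue[OF assms(1) _ nbr that(3,1,2)])
      show "a \<in> \<rat>"
        using rat eigenvalue_indexed_mat[OF pair_finite_verts that]
        by (simp add: transition_matrix_def)
    qed
  qed (use pair_finite_verts E in auto)
  then obtain p where p: "p \<noteq> 0" "degree p \<le> card E"
    "\<forall>s\<in>pverts G. poly_action (pverts G) ?T p (\<lambda>w. if w = v then 1 else 0) s = 0"
    by blast
  \<comment> \<open>Since \<open>n\<close> is at least 5, some vertex on a shortest walk lies at
    distance exactly \<open>degree p\<close> from \<open>v\<close>.\<close>
  then have "degree p \<le> n" using n \<open>card E \<le> 5\<close> by linarith
  then obtain w where w: "(w, v) \<in> parcs G ^^ degree p" "\<forall>j<degree p. (w, v) \<notin> parcs G ^^ j"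
    using relpow_intermediate_distance[OF uv] by blast
  have "w \<in> pverts G"
    using relpow_imp_awalk[OF w(1) v] by auto
  then show False
    using transition_annihilating_poly_degree[OF p(3,1) _ w(1)] w(2) by blast
qed

end

theorem theorem1p2:
  fixes G :: "'a pair_pre_digraph"
  assumes "pair_graph G"
    and "Digraph_Component.connected (with_proj G)"
    and "periodic_graph G"
    and "\<forall>z::complex. eigenvalue (transition_matrix G) z \<longrightarrow> z \<in> \<rat>"
  shows "graph_diam G < 5"
proof -
  interpret pair_graph G by fact
  have ne: "pverts G \<noteq> {}"
    using assms(2) by (auto simp: Digraph_Component.connected_def strongly_connected_def
        mk_symmetric_def)
  have "graph_dist G u v < 5" if uv: "u \<in> pverts G" "v \<in> pverts G" for u v
  proof -
    obtain m where m: "(u, v) \<in> parcs G ^^ m"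
      using connected_imp_relpow[OF assms(2) uv] by blast
    define n where "n = (LEAST n. (u, v) \<in> parcs G ^^ n)"
    have n: "(u, v) \<in> parcs G ^^ n" "\<And>j. (u, v) \<in> parcs G ^^ j \<Longrightarrow> n \<le> j"
      unfolding n_def by (rule LeastI[where P = "\<lambda>n. (u, v) \<in> parcs G ^^ n", OF m], rule Least_le)
    have "n \<le> 4"
    \<comment> \<open>Two distinct vertices and connectedness give every vertex a neighbour; a
      one-vertex graph has no arcs and falls under the first case.\<close>
    proof (cases "u = v")
      case True
      then show ?thesis using n(2)[of 0] by simp
    next
      case False
      have "\<exists>y. (x, y) \<in> parcs G" if x: "x \<in> pverts G" for x
      proof -
        obtain y where y: "y \<in> pverts G" "y \<noteq> x" using uv False by metis
        obtain k where "(x, y) \<in> parcs G ^^ k"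
          using connected_imp_relpow[OF assms(2) x y(1)] by blast
        then show ?thesis
          using y(2) by (cases k) (auto simp del: relpow.simps(2) dest: relpow_Suc_D2)
      qed
      then show ?thesis
        using periodic_rational_distance[OF assms(3,4) _ n uv(2)] by blast
    qed
    then have "ereal (real n) < 5" by simp
    then show ?thesis
      using graph_dist_le_relpow[OF n(1) uv(2)] by (rule le_less_trans[rotated])
  qed
  then show ?thesis
    unfolding graph_diam_def using ne pair_finite_verts by (subst Max_less_iff) auto
qed

end
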